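(* Let $d,n\in\mathbb{N}$, let $B\in\mathbb{R}^{d\times d}$ be a Frolov matrix, let $\psi:\mathbb{R}\to\mathbb{R}$ be an infinitely differentiable function such that $\psi|_{(-\infty,0)}=0$, $\psi|_{(1,\infty)}=1$ and $\psi|_{(0,1)}:(0,1)\to(0,1)$ is a diffeomorphism, and let $U$ and $V$ be independent random vectors uniformly distributed in $[1,2^{1/d}]^d$ and $[0,1]^d$, respectively. The method $\widetilde{Q}_{n^{1/d}\hat{U}B}^V$ is well-defined and unbiased on $L^1([0,1]^d)$; that is, for every $f\in L^1([0,1]^d)$ the quantity $\widetilde{Q}_{n^{1/d}\hat{U}B}^V(f)$ is almost surely well-defined and \[ \mathbb{E}\left(\widetilde{Q}_{n^{1/d}\hat{U}B}^V(f)\right)=I_d(f). \]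
   Context: Notation: $\mathbb{N}=\{1,2,\dots\}$; for $f\in L^1([0,1]^d)$ (real-valued), $I_d(f)=\int_{[0,1]^d} f(x)\,dx$. For $u\in\mathbb{R}^d$, $\hat{u}=\mathrm{diag}(u_1,\dots,u_d)$. Put $\Psi:\mathbb{R}^d\to\mathbb{R}^d$, $\Psi(x)=(\psi(x_1),\dots,\psi(x_d))^\top$, and $|D\Psi(x)|=\det D\Psi(x)=\prod_{i=1}^d\psi'(x_i)$. For an invertible matrix $S\in\mathbb{R}^{d\times d}$, $v\in\mathbb{R}^d$ and $f:[0,1]^d\to\mathbb{R}$, the transformed quadrature rule is \[\widetilde{Q}_S^v(f)=\frac{1}{|\det S|}\sum_{m\in\mathbb{Z}^d} f\left(\Psi\left(S^{-\top}(m+v)\right)\right)\cdot\left|D\Psi\left(S^{-\top}(m+v)\right)\right|,\] where $S^{-\top}$ is the transpose of the inverse of $S$ (terms with $S^{-\top}(m+v)\notin[0,1]^d$ vanish). A matrix $B\in\mathbb{R}^{d\times d}$ is a Frolov matrix if: (a) $B$ is invertible; (b) $\left|\prod_{j=1}^d (Bm)_j\right|\geq 1$ for every $m\in\mathbb{Z}^d\setminus\{0\}$; (c) for all $x,y\in\mathbb{R}^d$ the box $[x,y]=\{z\in\mathbb{R}^d : z_j \text{ lies between } x_j \text{ and } y_j \text{ (inclusive) for } j=1,\dots,d\}$ with volume $V_0=\prod_{j=1}^d|x_j-y_j|$ contains at most $V_0+1$ lattice points $Bm$, $m\in\mathbb{Z}^d$. *)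

theory Defs
  imports "HOL-Probability.Probability"
begin

text \<open>The domain \<open>A\<close> is meant to be open, so that all iterated derivatives at a point of \<open>A\<close>
  depend only on the values of \<open>f\<close> on \<open>A\<close>.\<close>
definition smooth_on :: "(real \<Rightarrow> real) \<Rightarrow> real set \<Rightarrow> bool" where
  "smooth_on f A \<longleftrightarrow> (\<forall>k. \<forall>x\<in>A. (deriv ^^ k) f field_differentiable (at x))"

definition diffeomorphism_between :: "(real \<Rightarrow> real) \<Rightarrow> real set \<Rightarrow> real set \<Rightarrow> bool" where
  "diffeomorphism_between f A B \<longleftrightarrow>
     bij_betw f A B \<and> smooth_on f A \<and> smooth_on (inv_into A f) B"

definition int_lattice :: "(real ^ 'd) set" where
  "int_lattice = {m. \<forall>i. m $ i \<in> \<int>}"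

text \<open>The corners of the box in \<open>frolov_matrix\<close> are not assumed to be ordered.\<close>
definition box_between :: "real ^ 'd \<Rightarrow> real ^ 'd \<Rightarrow> (real ^ 'd) set" where
  "box_between x y = {z. \<forall>j. min (x $ j) (y $ j) \<le> z $ j \<and> z $ j \<le> max (x $ j) (y $ j)}"

definition frolov_matrix :: "real ^ 'd ^ 'd \<Rightarrow> bool" where
  "frolov_matrix B \<longleftrightarrow>
     invertible B \<and>
     (\<forall>m\<in>int_lattice - {0}. \<bar>\<Prod>j\<in>UNIV. (B *v m) $ j\<bar> \<ge> 1) \<and>
     (\<forall>x y. finite (box_between x y \<inter> (*v) B ` int_lattice) \<and>
        real (card (box_between x y \<inter> (*v) B ` int_lattice))
          \<le> (\<Prod>j\<in>UNIV. \<bar>x $ j - y $ j\<bar>) + 1)"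

definition diag_matrix :: "real ^ 'd \<Rightarrow> real ^ 'd ^ 'd" where
  "diag_matrix u = (\<chi> i j. if i = j then u $ i else 0)"

definition Psi :: "(real \<Rightarrow> real) \<Rightarrow> real ^ 'd \<Rightarrow> real ^ 'd" where
  "Psi \<psi> x = (\<chi> i. \<psi> (x $ i))"

definition quad_summand ::
    "(real \<Rightarrow> real) \<Rightarrow> real ^ 'd ^ 'd \<Rightarrow> real ^ 'd \<Rightarrow> (real ^ 'd \<Rightarrow> real) \<Rightarrow> real ^ 'd \<Rightarrow> real" where
  "quad_summand \<psi> S v f m =
     (let x = transpose (matrix_inv S) *v (m + v)
      in f (Psi \<psi> x) * det (jacobian (Psi \<psi>) (at x)))"

text \<open>For \<open>\<psi>\<close> as in the theorem, \<open>Psi \<psi>\<close> maps into the unit cube and its Jacobian determinant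
  vanishes off the cube. So the values of \<open>f\<close> outside the cube are irrelevant, and the sum over
  all of the lattice is the sum over the nodes inside the cube.\<close>
definition transformed_quadrature ::
    "(real \<Rightarrow> real) \<Rightarrow> real ^ 'd ^ 'd \<Rightarrow> real ^ 'd \<Rightarrow> (real ^ 'd \<Rightarrow> real) \<Rightarrow> real" where
  "transformed_quadrature \<psi> S v f =
     1 / \<bar>det S\<bar> * (\<Sum>\<^sub>\<infinity>m\<in>int_lattice. quad_summand \<psi> S v f m)"

definition random_frolov_matrix :: "nat \<Rightarrow> real ^ 'd ^ 'd \<Rightarrow> real ^ 'd \<Rightarrow> real ^ 'd ^ 'd" where
  "random_frolov_matrix n B u =
     (real n powr (1 / real CARD('d))) *\<^sub>R (diag_matrix u ** B)"

definition unit_cube :: "(real ^ 'd) set" where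
  "unit_cube = cbox 0 (\<chi> i. 1)"

definition dilation_cube :: "(real ^ 'd) set" where
  "dilation_cube = cbox (\<chi> i. 1) (\<chi> i. 2 powr (1 / real CARD('d)))"

definition uniformly_distributed ::
    "'w measure \<Rightarrow> ('w \<Rightarrow> real ^ 'd) \<Rightarrow> (real ^ 'd) set \<Rightarrow> bool" where
  "uniformly_distributed M X A \<longleftrightarrow>
     X \<in> borel_measurable M \<and> distr M borel X = uniform_measure lborel A"

text \<open>A function in \<open>L\<^sup>1\<close> is represented by any Lebesgue integrable function on the cube. Composing
  such a representative with the random nodes gives a function that agrees almost surely with a
  random variable on \<open>M\<close>, but need not itself be measurable if \<open>M\<close> is not complete. Its expectation
  is therefore taken with respect to the completion of \<open>M\<close>, which changes neither null events nor
  the expectation of any random variable on \<open>M\<close>.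

  The method is well-defined at \<open>f\<close> if almost surely the matrix is invertible, the series converges
  (absolutely, as \<open>summable_on\<close> means in the reals), and the value does not depend on the chosen
  representative of \<open>f\<close>.\<close>
definition almost_surely_well_defined ::
    "'w measure \<Rightarrow> (real \<Rightarrow> real) \<Rightarrow> ('w \<Rightarrow> real ^ 'd ^ 'd) \<Rightarrow> ('w \<Rightarrow> real ^ 'd)
      \<Rightarrow> (real ^ 'd \<Rightarrow> real) \<Rightarrow> bool" where
  "almost_surely_well_defined M \<psi> S V f \<longleftrightarrow>
     (AE \<omega> in M. invertible (S \<omega>) \<and> quad_summand \<psi> (S \<omega>) (V \<omega>) f summable_on int_lattice) \<and>
     (\<forall>g. (AE x in lebesgue_on unit_cube. g x = f x) \<longrightarrow>
        (AE \<omega> in M. transformed_quadrature \<psi> (S \<omega>) (V \<omega>) g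
                    = transformed_quadrature \<psi> (S \<omega>) (V \<omega>) f))"

end

(* Let A be the inverse transpose of the random matrix. The quadrature is the sum over the lattice
   points m of |det A| |D Psi(x)| f(Psi(x)) with x = A(m + v). For a fixed invertible A, averaging
   over v in the unit cube turns the sum into an integral over R^d, since the lattice translates of
   the cube tile the space; the linear substitution by A then absorbs |det A|, and the substitution
   by Psi absorbs |D Psi|, leaving the integral of f over the cube. As this does not depend on A, the
   same holds for every random A that is independent of v. Hence the product of the probability
   space and the counting measure of the lattice, weighted by |det A| |D Psi(x)|, is mapped by the
   nodes Psi(x) to the uniform distribution on the cube; summability, independence of the
   representative of f and unbiasedness follow from this by Fubini. *)

theory Submission
  imports Defs
begin

section \<open>Linear substitutions in Lebesgue integrals\<close>

lemma prod_Basis_cart: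
  fixes g :: "real ^ 'n \<Rightarrow> 'b::comm_monoid_mult"
  shows "(\<Prod>b\<in>Basis. g b) = (\<Prod>i\<in>UNIV. g (axis i 1))"
proof -
  have "(Basis :: (real ^ 'n) set) = (\<lambda>i. axis i 1) ` UNIV"
    by (auto simp: Basis_vec_def)
  moreover have "inj (\<lambda>i :: 'n. axis i (1 :: real))"
    by (simp add: inj_on_def axis_eq_axis)
  ultimately show ?thesis
    using prod.reindex[of "\<lambda>i :: 'n. axis i (1 :: real)" UNIV g] by (simp only: comp_def)
qed

lemma nn_integral_lborel_scale:
  fixes c :: "'n::finite \<Rightarrow> real" and h :: "real ^ 'n \<Rightarrow> ennreal"
  assumes c: "\<And>i. c i \<noteq> 0" and [measurable]: "h \<in> borel_measurable borel"
  shows "ennreal \<bar>\<Prod>i\<in>UNIV. c i\<bar> * (\<integral>\<^sup>+x. h (\<chi> i. c i * x $ i) \<partial>lborel) = (\<integral>\<^sup>+x. h x \<partial>lborel)"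
proof -
  \<comment> \<open>\<open>lborel_affine_euclidean\<close> takes its factors as a function of basis
    vectors; the sum picks \<open>c i\<close> at \<open>axis i 1\<close>.\<close>
  define C :: "real ^ 'n \<Rightarrow> real" where "C b = (\<Sum>i\<in>UNIV. c i * b $ i)" for b
  have C: "C (axis i 1) = c i" for i
    by (simp add: C_def axis_def if_distrib [of "(*) _"] cong: if_cong)
  define T :: "real ^ 'n \<Rightarrow> real ^ 'n" where "T x = 0 + (\<Sum>b\<in>Basis. (C b * (x \<bullet> b)) *\<^sub>R b)" for x
  have T: "T x = (\<chi> i. c i * x $ i)" for x
  proof -
    have "T x \<bullet> axis i 1 = (\<chi> i. c i * x $ i) \<bullet> axis i 1" for i
      by (simp add: T_def axis_in_Basis_iff C) (simp add: inner_axis)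
    then show ?thesis by (simp add: vec_eq_iff inner_axis)
  qed
  have [measurable]: "T \<in> borel_measurable borel"
    by (simp add: T_def[abs_def])
  have "(lborel :: (real ^ 'n) measure) = density (distr lborel borel T) (\<lambda>_. (\<Prod>j\<in>Basis. \<bar>C j\<bar>))"
    unfolding T_def[abs_def] by (rule lborel_affine_euclidean) (use c in \<open>auto simp: Basis_vec_def C\<close>)
  then have "(\<integral>\<^sup>+x. h x \<partial>lborel) = (\<integral>\<^sup>+x. h x \<partial>density (distr lborel borel T) (\<lambda>_. (\<Prod>j\<in>Basis. \<bar>C j\<bar>)))"
    by simp
  also have "\<dots> = (\<Prod>j\<in>Basis. \<bar>C j\<bar>) * (\<integral>\<^sup>+x. h (T x) \<partial>lborel)"
    by (simp add: nn_integral_density nn_integral_cmult nn_integral_distr prod_nonneg)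
  finally show ?thesis
    by (simp add: prod_Basis_cart C T abs_prod)
qed

text \<open>The preimage of a box is the box with its corners permuted back. Its volume is the same
  product in another order, and boxes determine \<open>lborel\<close>.\<close>

lemma lborel_distr_permute:
  fixes p :: "'n::finite \<Rightarrow> 'n"
  assumes p: "bij p"
  shows "distr lborel borel (\<lambda>x :: real ^ 'n. \<chi> i. x $ p i) = lborel"
proof (rule lborel_eqI[symmetric])
  let ?T = "\<lambda>x :: real ^ 'n. \<chi> i. x $ p i"
  fix l u :: "real ^ 'n"
  assume "\<And>b. b \<in> Basis \<Longrightarrow> l \<bullet> b \<le> u \<bullet> b"
  then have le: "l $ i \<le> u $ i" for i
    by (metis axis_in_Basis_iff cart_eq_inner_axis Basis_real_def insertI1)
  let ?q = "inv p"
  have pq: "p (?q i) = i" "?q (p i) = i" for i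
    using p by (auto simp: bij_def surj_f_inv_f)
  have "?T -` box l u = box (\<chi> i. l $ ?q i) (\<chi> i. u $ ?q i)"
    by (auto simp: mem_box_cart) (metis pq)+
  moreover have "?T \<in> borel_measurable borel"
    by (intro borel_measurable_continuous_onI continuous_intros)
  ultimately have "emeasure (distr lborel borel ?T) (box l u)
      = emeasure lborel (box (\<chi> i. l $ ?q i) (\<chi> i. u $ ?q i) :: (real ^ 'n) set)"
    by (simp add: emeasure_distr)
  also have "\<dots> = (\<Prod>b\<in>Basis. ((\<chi> i. u $ ?q i) - (\<chi> i. l $ ?q i)) \<bullet> (b :: real ^ 'n))"
    by (rule emeasure_lborel_box) (use le in \<open>auto simp: Basis_vec_def inner_axis\<close>)
  also have "\<dots> = (\<Prod>i\<in>UNIV. u $ ?q i - l $ ?q i)"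
    by (simp add: prod_Basis_cart inner_axis)
  also have "(\<Prod>i\<in>UNIV. u $ ?q i - l $ ?q i) = (\<Prod>i\<in>UNIV. u $ i - l $ i)"
    using bij_imp_bij_inv[OF p] by (rule prod.reindex_bij_betw[of _ UNIV UNIV "\<lambda>i. u $ i - l $ i"])
  finally show "emeasure (distr lborel borel ?T) (box l u) = ennreal (\<Prod>b\<in>Basis. (u - l) \<bullet> b)"
    by (simp add: prod_Basis_cart inner_axis)
qed simp

text \<open>Since \<open>m\<close> and \<open>n\<close> differ, the shear moves coordinate
  \<open>m\<close> by an amount that is constant in that coordinate. Integrating over coordinate
  \<open>m\<close> first, translation invariance on the line removes it.\<close>

lemma nn_integral_lborel_shear:
  fixes h :: "real ^ 'n \<Rightarrow> ennreal"
  assumes mn: "m \<noteq> n" and [measurable]: "h \<in> borel_measurable borel"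
  shows "(\<integral>\<^sup>+x. h (x + axis m (c * x $ n)) \<partial>lborel) = (\<integral>\<^sup>+x. h x \<partial>lborel)"
proof -
  interpret product_sigma_finite "\<lambda>_ :: real ^ 'n. lborel :: real measure" ..
  let ?m = "axis m 1 :: real ^ 'n" and ?n = "axis n 1 :: real ^ 'n"
  let ?I = "Basis - {?m}"
  \<comment> \<open>\<open>lborel\<close> is the image under \<open>V\<close> of a product measure
    over \<open>Basis\<close>; this makes it possible to integrate out a single coordinate.\<close>
  define V :: "(real ^ 'n \<Rightarrow> real) \<Rightarrow> real ^ 'n" where "V f = (\<Sum>b\<in>Basis. f b *\<^sub>R b)" for f
  have [measurable]: "V \<in> borel_measurable (Pi\<^sub>M Basis (\<lambda>_. lborel))"
    unfolding V_def[abs_def] by measurable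
  have ins: "insert ?m ?I = Basis"
    by (auto simp: axis_in_Basis_iff)
  have ne: "?n \<noteq> ?m" and n_Basis: "?n \<in> Basis" and m_Basis: "?m \<in> Basis"
    using mn by (auto simp: axis_eq_axis axis_in_Basis_iff)
  have Vn: "V f $ n = f ?n" for f
  proof -
    have "V f $ n = V f \<bullet> ?n" by (simp add: inner_axis)
    also have "\<dots> = f ?n" unfolding V_def using n_Basis by simp
    finally show ?thesis .
  qed
  have Vupd: "V (x(?m := y)) = V (x(?m := 0)) + axis m y" for x y
  proof -
    have "axis m y = y *\<^sub>R ?m"
      by (simp add: vec_eq_iff axis_def)
    moreover have "(\<Sum>b\<in>?I. (x(?m := y)) b *\<^sub>R b) = (\<Sum>b\<in>?I. (x(?m := 0)) b *\<^sub>R b)"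
      by (rule sum.cong) auto
    ultimately show ?thesis
      unfolding V_def by (simp add: sum.remove[OF finite_Basis m_Basis])
  qed
  have shift: "(\<integral>\<^sup>+y. k (y + t) \<partial>lborel) = (\<integral>\<^sup>+y. k y \<partial>lborel)"
    if "k \<in> borel_measurable borel" for k :: "real \<Rightarrow> ennreal" and t
    using that nn_integral_distr[of "(+) t" lborel borel k] by (simp add: lborel_distr_plus add.commute)
  have eq: "(\<integral>\<^sup>+x. k x \<partial>lborel)
      = (\<integral>\<^sup>+x. (\<integral>\<^sup>+y. k (V (x(?m := y))) \<partial>lborel) \<partial>Pi\<^sub>M ?I (\<lambda>_. lborel))"
    if [measurable]: "k \<in> borel_measurable borel" for k :: "real ^ 'n \<Rightarrow> ennreal"
  proof -
    have "(\<integral>\<^sup>+x. k x \<partial>lborel) = (\<integral>\<^sup>+x. k (V x) \<partial>Pi\<^sub>M (insert ?m ?I) (\<lambda>_. lborel))"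
      unfolding ins by (subst lborel_eq) (simp add: nn_integral_distr V_def)
    also have "\<dots> = (\<integral>\<^sup>+x. (\<integral>\<^sup>+y. k (V (x(?m := y))) \<partial>lborel) \<partial>Pi\<^sub>M ?I (\<lambda>_. lborel))"
      by (rule product_nn_integral_insert) (simp, simp, unfold ins, measurable)
    finally show ?thesis .
  qed
  have inner: "(\<integral>\<^sup>+y. h (V (x(?m := y)) + axis m (c * V (x(?m := y)) $ n)) \<partial>lborel)
      = (\<integral>\<^sup>+y. h (V (x(?m := y))) \<partial>lborel)" for x
  proof -
    have ax: "axis m s + axis m t = (axis m (s + t) :: real ^ 'n)" for s t :: real
      by (simp add: vec_eq_iff axis_def)
    have eq_scaleR: "(\<lambda>y. axis m y :: real ^ 'n) = (\<lambda>y. y *\<^sub>R ?m)"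
      by (simp add: vec_eq_iff axis_def fun_eq_iff)
    have [measurable]: "(\<lambda>y. axis m y :: real ^ 'n) \<in> borel_measurable borel"
      by (subst eq_scaleR) measurable
    \<comment> \<open>\<open>w\<close> carries the other coordinates and does not depend on
      \<open>y\<close>, so the shear becomes a shift by the constant
      \<open>c * x ?n\<close>.\<close>
    obtain w where w: "V (x(?m := y)) = w + axis m y" for y
      using Vupd by blast
    have "V (x(?m := y)) $ n = x ?n" for y
      using ne by (simp add: Vn)
    then have "(\<integral>\<^sup>+y. h (V (x(?m := y)) + axis m (c * V (x(?m := y)) $ n)) \<partial>lborel)
      = (\<integral>\<^sup>+y. h (w + axis m (y + c * x ?n)) \<partial>lborel)"
      by (simp add: w add.assoc ax)
    also have "\<dots> = (\<integral>\<^sup>+y. h (w + axis m y) \<partial>lborel)"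
      by (rule shift) measurable
    finally show ?thesis by (simp add: w)
  qed
  have cont: "continuous_on UNIV (\<lambda>x :: real ^ 'n. x + axis m (c * x $ n))"
  proof -
    have eq_scaleR: "(\<lambda>x :: real ^ 'n. x + axis m (c * x $ n)) = (\<lambda>x. x + (c * x $ n) *\<^sub>R ?m)"
      by (simp add: vec_eq_iff axis_def fun_eq_iff)
    show ?thesis by (subst eq_scaleR) (intro continuous_intros)
  qed
  have [measurable]: "(\<lambda>x :: real ^ 'n. x + axis m (c * x $ n)) \<in> borel_measurable borel"
    using cont by (rule borel_measurable_continuous_onI)
  show ?thesis
    by (subst (1 2) eq) (simp_all add: inner)
qed

text \<open>The change of variables theorems of the library need a well-ordered index type, which a
  finite type in general is not. So the matrix is decomposed into elementary ones instead.\<close>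

lemma nn_integral_lborel_matrix:
  fixes A :: "real ^ 'n ^ 'n" and h :: "real ^ 'n \<Rightarrow> ennreal"
  assumes "det A \<noteq> 0" and "h \<in> borel_measurable borel"
  shows "ennreal \<bar>det A\<bar> * (\<integral>\<^sup>+x. h (A *v x) \<partial>lborel) = (\<integral>\<^sup>+x. h x \<partial>lborel)"
proof -
  \<comment> \<open>The determinant condition belongs to the induction predicate, as matrices with a
    zero row occur in the induction and satisfy it vacuously. \<open>h\<close> is quantified because
    a product needs the formula for its right factor at the function
    \<open>h (A *v x)\<close>.\<close>
  define P where "P A \<longleftrightarrow> (det A \<noteq> 0 \<longrightarrow> (\<forall>h :: real ^ 'n \<Rightarrow> ennreal. h \<in> borel_measurable borel \<longrightarrow>
    ennreal \<bar>det A\<bar> * (\<integral>\<^sup>+x. h (A *v x) \<partial>lborel) = (\<integral>\<^sup>+x. h x \<partial>lborel)))"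
    for A :: "real ^ 'n ^ 'n"
  have meas: "(\<lambda>x. A *v x) \<in> borel_measurable borel" for A :: "real ^ 'n ^ 'n"
    by (intro borel_measurable_continuous_onI linear_continuous_on
        matrix_vector_mul_bounded_linear)
  have "P A"
  proof (rule induct_matrix_elementary)
    fix A B :: "real ^ 'n ^ 'n"
    assume P: "P A" "P B"
    show "P (A ** B)"
      unfolding P_def
    proof (intro impI allI)
      fix h :: "real ^ 'n \<Rightarrow> ennreal"
      assume "det (A ** B) \<noteq> 0" and h: "h \<in> borel_measurable borel"
      then have "det A \<noteq> 0" "det B \<noteq> 0"
        by (auto simp: det_mul)
      moreover have "(\<lambda>x. h (A *v x)) \<in> borel_measurable borel"
        using h meas by measurable
      ultimately have "ennreal \<bar>det B\<bar> * (\<integral>\<^sup>+x. h (A *v (B *v x)) \<partial>lborel) = (\<integral>\<^sup>+x. h (A *v x) \<partial>lborel)"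
        "ennreal \<bar>det A\<bar> * (\<integral>\<^sup>+x. h (A *v x) \<partial>lborel) = (\<integral>\<^sup>+x. h x \<partial>lborel)"
        using P h unfolding P_def by blast+
      then show "ennreal \<bar>det (A ** B)\<bar> * (\<integral>\<^sup>+x. h (A ** B *v x) \<partial>lborel) = (\<integral>\<^sup>+x. h x \<partial>lborel)"
        by (simp add: det_mul abs_mult ennreal_mult mult.assoc matrix_vector_mul_assoc)
    qed
  next
    fix A :: "real ^ 'n ^ 'n" and i
    assume "row i A = 0"
    then show "P A" by (simp add: P_def det_zero_row)
  next
    fix A :: "real ^ 'n ^ 'n"
    assume A: "\<And>i j. i \<noteq> j \<Longrightarrow> A $ i $ j = 0"
    have "(A *v x) $ i = A $ i $ i * x $ i" for x i
    proof -
      have "(A *v x) $ i = (\<Sum>j\<in>UNIV. if j = i then A $ i $ i * x $ i else 0)"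
        unfolding matrix_vector_mult_def vec_lambda_beta by (rule sum.cong) (auto simp: A)
      then show ?thesis by simp
    qed
    then have "A *v x = (\<chi> i. A $ i $ i * x $ i)" for x
      by (simp add: vec_eq_iff)
    then show "P A"
      using nn_integral_lborel_scale[of "\<lambda>i. A $ i $ i"]
      by (simp add: P_def det_diagonal[OF A])
  next
    fix m n :: 'n
    assume "m \<noteq> n"
    let ?p = "Transposition.transpose m n"
    let ?S = "\<chi> i j. mat 1 $ i $ ?p j :: real ^ 'n ^ 'n"
    have p: "?p permutes UNIV" by (rule permutes_swap_id) auto
    have S: "?S *v x = (\<chi> i. x $ ?p i)" for x
    proof -
      have "(?S *v x) $ i = x $ ?p i" for i
      proof -
        have "(?S *v x) $ i = (\<Sum>j\<in>UNIV. if j = ?p i then x $ j else 0)"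
          unfolding matrix_vector_mult_def mat_def vec_lambda_beta
          by (rule sum.cong) (auto simp: Transposition.transpose_def)
        then show ?thesis by simp
      qed
      then show ?thesis by (simp add: vec_eq_iff)
    qed
    have det_S: "\<bar>det ?S\<bar> = 1"
      using det_permute_columns[OF p, of "mat 1 :: real ^ 'n ^ 'n"]
      by (simp add: abs_mult sign_def)
    have "(\<integral>\<^sup>+x. h (?S *v x) \<partial>lborel) = (\<integral>\<^sup>+x. h x \<partial>lborel)"
      if h: "h \<in> borel_measurable borel" for h :: "real ^ 'n \<Rightarrow> ennreal"
    proof -
      have T: "(\<lambda>x :: real ^ 'n. \<chi> i. x $ ?p i) \<in> lborel \<rightarrow>\<^sub>M borel"
        using meas[of ?S] unfolding S by simp
      have "(\<integral>\<^sup>+x. h x \<partial>distr lborel borel (\<lambda>x. \<chi> i. x $ ?p i)) = (\<integral>\<^sup>+x. h (\<chi> i. x $ ?p i) \<partial>lborel)"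
        by (rule nn_integral_distr[OF T]) (simp add: h)
      then show ?thesis
        unfolding S lborel_distr_permute[OF permutes_bij[OF p]] by (rule sym)
    qed
    then show "P ?S"
      unfolding P_def det_S by (metis ennreal_1 mult_1)
  next
    fix m n :: 'n and c :: real
    assume mn: "m \<noteq> n"
    let ?E = "\<chi> i j. if i = m \<and> j = n then c else of_bool (i = j) :: real ^ 'n ^ 'n"
    have E: "?E *v x = x + axis m (c * x $ n)" for x
    proof -
      have "(?E *v x) $ i = (x + axis m (c * x $ n)) $ i" for i
      proof -
        have "(?E *v x) $ i = (\<Sum>j\<in>UNIV. (if j = i then x $ j else 0) + (if j = n then (if i = m then c * x $ j else 0) else 0))"
          unfolding matrix_vector_mult_def vec_lambda_beta
          by (rule sum.cong) (use mn in auto)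
        then show ?thesis by (simp add: sum.distrib axis_def)
      qed
      then show ?thesis by (simp add: vec_eq_iff)
    qed
    have "?E = (\<chi> k. if k = m then row m (mat 1) + c *s row n (mat 1) else row k (mat 1))"
      using mn by (auto simp: vec_eq_iff row_def mat_def)
    then have det_E: "det ?E = 1"
      using det_row_operation[OF mn, of "mat 1 :: real ^ 'n ^ 'n" c] by (simp add: det_I)
    show "P ?E"
      unfolding P_def E det_E using nn_integral_lborel_shear[OF mn, of _ c] by simp
  qed
  then show ?thesis using assms unfolding P_def by blast
qed

section \<open>Reduction of the substitution by \<open>Psi\<close> to one dimension\<close>

text \<open>Boxes are stable under intersection, generate the Borel sets and exhaust the space, so
  measures that are finite on them are fixed by their values there.\<close>

lemma borel_measure_eqI_box:
  fixes M N :: "'a::euclidean_space measure"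
  assumes "sets M = sets borel" and "sets N = sets borel"
    and "\<And>l u. emeasure M (box l u) = emeasure N (box l u)"
    and "\<And>l u. emeasure N (box l u) \<noteq> \<infinity>"
  shows "M = N"
proof (rule measure_eqI_generator_eq)
  let ?E = "range (\<lambda>(l, u). box l u :: 'a set)"
  let ?A = "\<lambda>n::nat. box (- (real n *\<^sub>R One)) (real n *\<^sub>R One) :: 'a set"
  show "Int_stable ?E"
    by (auto simp: Int_stable_def box_Int_box)
  show "?E \<subseteq> Pow UNIV" "sets M = sigma_sets UNIV ?E" "sets N = sigma_sets UNIV ?E"
    by (simp_all add: assms borel_eq_box)
  show "range ?A \<subseteq> ?E" "(\<Union>n. ?A n) = UNIV"
    unfolding UN_box_eq_UNIV by auto
qed (use assms in auto)

text \<open>Both sides integrate \<open>h\<close> against Borel measures, so comparing these on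
  boxes suffices. There the indicators and the weight are products over the coordinates, and each
  factor is an instance of \<open>one_dim\<close>.\<close>

lemma nn_integral_Psi_transfer:
  fixes \<psi> \<psi>' :: "real \<Rightarrow> real" and h :: "real ^ 'n \<Rightarrow> ennreal"
  assumes [measurable]: "\<psi> \<in> borel_measurable borel" "\<psi>' \<in> borel_measurable borel"
    and nonneg: "\<And>t. 0 \<le> \<psi>' t"
    and one_dim: "\<And>k. k \<in> borel_measurable borel \<Longrightarrow>
      (\<integral>\<^sup>+t. k (\<psi> t) * ennreal (\<psi>' t) \<partial>lborel) = (\<integral>\<^sup>+t. k t * indicator {0..1} t \<partial>lborel)"
    and [measurable]: "h \<in> borel_measurable borel"
  shows "(\<integral>\<^sup>+x. h (Psi \<psi> x) * ennreal (\<Prod>i\<in>UNIV. \<psi>' (x $ i)) \<partial>lborel)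
    = (\<integral>\<^sup>+x. h x * indicator unit_cube x \<partial>lborel)"
proof -
  let ?w = "\<lambda>x :: real ^ 'n. ennreal (\<Prod>i\<in>UNIV. \<psi>' (x $ i))"
  let ?M = "distr (density lborel ?w) borel (Psi \<psi>)"
  let ?N = "density lborel (indicator (unit_cube :: (real ^ 'n) set))"
  have [measurable]: "(\<lambda>x :: real ^ 'n. x $ i) \<in> borel_measurable borel" for i
    by (intro borel_measurable_continuous_onI continuous_intros)
  have [measurable]: "Psi \<psi> \<in> borel_measurable (borel :: (real ^ 'n) measure)"
    by (subst borel_measurable_euclidean_space) (auto simp: Psi_def Basis_vec_def inner_axis)
  have [measurable]: "(unit_cube :: (real ^ 'n) set) \<in> sets borel"
    by (simp add: unit_cube_def)
  have axis: "x \<bullet> axis i 1 = x $ i" for x :: "real ^ 'n" and i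
    by (simp add: inner_axis)
  have ind_box: "indicator (box l u) x = (\<Prod>i\<in>UNIV. indicator {l $ i<..<u $ i} (x $ i) :: ennreal)"
    for l u x :: "real ^ 'n"
    by (auto simp: indicator_def mem_box_cart prod_zero_iff)
  have ind_cube: "indicator unit_cube x = (\<Prod>i\<in>UNIV. indicator {0..1} (x $ i) :: ennreal)"
    for x :: "real ^ 'n"
    by (auto simp: indicator_def unit_cube_def mem_box_cart prod_zero_iff)
  have prod_integral: "(\<integral>\<^sup>+x. (\<Prod>i\<in>UNIV. f i (x $ i)) \<partial>lborel) = (\<Prod>i\<in>UNIV. \<integral>\<^sup>+t. f i t \<partial>lborel)"
    if "\<And>i. f i \<in> borel_measurable borel" for f :: "'n \<Rightarrow> real \<Rightarrow> ennreal"
  proof -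
    \<comment> \<open>\<open>nn_integral_lborel_prod\<close> indexes its factors by basis vectors;
      \<open>F\<close> recovers the index, which is unique by \<open>axis_eq_axis\<close>.\<close>
    define F :: "real ^ 'n \<Rightarrow> real \<Rightarrow> ennreal" where "F b = f (SOME i. b = axis i 1)" for b
    have F: "F (axis i 1) = f i" for i
      by (simp add: F_def axis_eq_axis)
    have "(\<integral>\<^sup>+x. (\<Prod>b\<in>Basis. F b (x \<bullet> b)) \<partial>lborel) = (\<Prod>b\<in>Basis. \<integral>\<^sup>+t. F b t \<partial>lborel)"
      by (rule nn_integral_lborel_prod) (auto simp: F_def that)
    then show ?thesis by (simp add: prod_Basis_cart F axis)
  qed
  have "?M = ?N"
  proof (rule borel_measure_eqI_box)
    fix l u :: "real ^ 'n"
    have "emeasure ?M (box l u) = (\<integral>\<^sup>+x. indicator (box l u) x \<partial>?M)"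
      by simp
    also have "\<dots> = (\<integral>\<^sup>+x. ?w x * indicator (box l u) (Psi \<psi> x) \<partial>lborel)"
      by (subst nn_integral_distr) (simp_all add: nn_integral_density)
    also have "\<dots> = (\<integral>\<^sup>+x. (\<Prod>i\<in>UNIV. indicator {l $ i<..<u $ i} (\<psi> (x $ i)) * ennreal (\<psi>' (x $ i))) \<partial>lborel)"
      by (simp add: ind_box Psi_def prod.distrib nonneg mult.commute flip: prod_ennreal)
    also have "\<dots> = (\<Prod>i\<in>UNIV. \<integral>\<^sup>+t. indicator {l $ i<..<u $ i} (\<psi> t) * ennreal (\<psi>' t) \<partial>lborel)"
      by (rule prod_integral) measurable
    also have "\<dots> = (\<Prod>i\<in>UNIV. \<integral>\<^sup>+t. indicator {l $ i<..<u $ i} t * indicator {0..1} t \<partial>lborel)"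
      by (intro prod.cong refl one_dim) measurable
    also have "\<dots> = (\<integral>\<^sup>+x. (\<Prod>i\<in>UNIV. indicator {l $ i<..<u $ i} (x $ i) * indicator {0..1} (x $ i)) \<partial>lborel)"
      by (rule prod_integral[symmetric]) measurable
    also have "\<dots> = (\<integral>\<^sup>+x. indicator unit_cube x * indicator (box l u) x \<partial>lborel)"
      by (simp add: ind_box ind_cube prod.distrib mult.commute)
    also have "\<dots> = emeasure ?N (box l u)"
      by (simp add: emeasure_density)
    finally show "emeasure ?M (box l u) = emeasure ?N (box l u)" .
    \<comment> \<open>The cube measure is dominated by \<open>lborel\<close>, which is finite on
      boxes; this is the finiteness that uniqueness asks for.\<close>
    have "emeasure ?N (box l u) = (\<integral>\<^sup>+x. indicator unit_cube x * indicator (box l u) x \<partial>lborel)"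
      by (simp add: emeasure_density)
    also have "\<dots> \<le> (\<integral>\<^sup>+x. indicator (box l u) x \<partial>lborel)"
      by (intro nn_integral_mono) (auto simp: indicator_def)
    also have "\<dots> = emeasure lborel (box l u)"
      by simp
    also have "\<dots> < \<infinity>"
      using emeasure_lborel_box_finite by blast
    finally show "emeasure ?N (box l u) \<noteq> \<infinity>" by simp
  qed simp_all
  then have "(\<integral>\<^sup>+x. h x \<partial>?M) = (\<integral>\<^sup>+x. h x \<partial>?N)" by simp
  then show ?thesis
    by (simp add: nn_integral_distr nn_integral_density mult.commute)
qed

section \<open>The transformation \<open>\<psi>\<close> of the unit interval and its
  Jacobian\<close>

locale unit_interval_transformation =
  fixes \<psi> :: "real \<Rightarrow> real"
  assumes smooth: "smooth_on \<psi> UNIV"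
    and left: "\<And>t. t < 0 \<Longrightarrow> \<psi> t = 0"
    and right: "\<And>t. t > 1 \<Longrightarrow> \<psi> t = 1"
    and diffeo: "diffeomorphism_between \<psi> {0<..<1} {0<..<1}"
begin

lemma has_derivative: "(\<psi> has_real_derivative deriv \<psi> t) (at t)"
  using smooth unfolding smooth_on_def
  by (metis UNIV_I funpow_0 DERIV_deriv_iff_field_differentiable)

lemma continuous_deriv: "continuous_on A (deriv \<psi>)"
proof -
  have "(deriv ^^ 1) \<psi> field_differentiable (at t)" for t
    using smooth unfolding smooth_on_def by blast
  then show ?thesis
    by (simp add: continuous_at_imp_continuous_on field_differentiable_imp_continuous_at)
qed

lemma continuous: "continuous_on A \<psi>"
  using has_derivative DERIV_isCont by (blast intro: continuous_at_imp_continuous_on)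

text \<open>The hypotheses leave the values at the endpoints open. Continuity forces them, since the
  set where \<open>\<psi>\<close> vanishes is closed; \<open>eq_1\<close> is the mirror
  image.\<close>

lemma eq_0: "t \<le> 0 \<Longrightarrow> \<psi> t = 0"
proof -
  have "closed {t. \<psi> t = 0}"
    using continuous[of UNIV] by (intro closed_Collect_eq) auto
  moreover have "{..<0} \<subseteq> {t. \<psi> t = 0}"
    using left by auto
  ultimately have "closure {..<0} \<subseteq> {t. \<psi> t = 0}"
    by (rule closure_minimal[rotated])
  then show "t \<le> 0 \<Longrightarrow> \<psi> t = 0" by auto
qed

lemma eq_1: "1 \<le> t \<Longrightarrow> \<psi> t = 1"
proof -
  have "closed {t. \<psi> t = 1}"
    using continuous[of UNIV] by (intro closed_Collect_eq) auto
  moreover have "{1<..} \<subseteq> {t. \<psi> t = 1}"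
    using right by auto
  ultimately have "closure {1<..} \<subseteq> {t. \<psi> t = 1}"
    by (rule closure_minimal[rotated])
  then show "1 \<le> t \<Longrightarrow> \<psi> t = 1" by auto
qed

lemma inside: "\<lbrakk>0 < t; t < 1\<rbrakk> \<Longrightarrow> 0 < \<psi> t \<and> \<psi> t < 1"
  using diffeo unfolding diffeomorphism_between_def bij_betw_def by force

lemma range: "0 \<le> \<psi> t \<and> \<psi> t \<le> 1"
  using eq_0[of t] eq_1[of t] inside[of t] by (cases "t \<le> 0"; cases "1 \<le> t") auto

text \<open>All values lie in the unit interval, so \<open>\<psi>\<close> is at a minimum where it
  is 0 and at a maximum where it is 1. This covers the endpoints too.\<close>

lemma deriv_outside:
  assumes "t \<le> 0 \<or> 1 \<le> t"
  shows "deriv \<psi> t = 0"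
  using assms
proof
  assume "t \<le> 0"
  then show ?thesis
    using DERIV_local_min[OF has_derivative, of 1 t] eq_0 range by auto
next
  assume "1 \<le> t"
  then show ?thesis
    using DERIV_local_max[OF has_derivative, of 1 t] eq_1 range by auto
qed

text \<open>A diffeomorphism of the open interval could also be decreasing; the value 0 at the left
  endpoint excludes this.\<close>

lemma deriv_nonneg: "0 \<le> deriv \<psi> t"
proof (cases "t \<le> 0 \<or> 1 \<le> t")
  case False
  have "inj_on \<psi> {0<..<1}"
    using diffeo unfolding diffeomorphism_between_def bij_betw_def by blast
  have "\<psi> x < \<psi> y" if "0 < x" "x < y" "y < 1" for x y
  proof -
    \<comment> \<open>Positivity inside extends injectivity to the left endpoint. A continuous
      injection on \<open>{0..y}\<close> is monotone, and a decreasing one would make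
      \<open>\<psi> x\<close> negative.\<close>
    have "inj_on \<psi> {0..y}"
    proof (rule inj_onI)
      fix a b assume ab: "a \<in> {0..y}" "b \<in> {0..y}" "\<psi> a = \<psi> b"
      show "a = b"
      proof (cases "a = 0 \<or> b = 0")
        case True
        then show ?thesis
          using ab that eq_0[of 0] inside[of a] inside[of b] by force
      next
        case False
        then show ?thesis
          using ab that \<open>inj_on \<psi> {0<..<1}\<close> by (auto dest: inj_onD)
      qed
    qed
    from continuous_inj_imp_mono[OF that(1,2) continuous this]
    show ?thesis
      using that eq_0[of 0] range[of x] by auto
  qed
  then have "mono_on {0<..<1} \<psi>"
    unfolding monotone_on_def by (metis greaterThanLessThan_iff order_le_less)
  then show ?thesis
    using has_derivative by (rule mono_on_imp_deriv_nonneg) (use False in auto)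
qed (use deriv_outside[of t] in simp)

lemma measurable [measurable]: "\<psi> \<in> borel_measurable borel" "deriv \<psi> \<in> borel_measurable borel"
  by (rule borel_measurable_continuous_onI, rule continuous continuous_deriv)+

text \<open>The library rule works on \<open>{0..1}\<close> and asks for a nonnegative derivative.
  Since \<open>deriv \<psi>\<close> vanishes outside this interval, the left integral may run over
  the whole line.\<close>

lemma nn_integral_substitution:
  fixes k :: "real \<Rightarrow> ennreal"
  assumes "k \<in> borel_measurable borel"
  shows "(\<integral>\<^sup>+t. k (\<psi> t) * ennreal (deriv \<psi> t) \<partial>lborel) = (\<integral>\<^sup>+t. k t * indicator {0..1} t \<partial>lborel)"
proof -
  have "(\<integral>\<^sup>+t. k t * indicator {\<psi> 0..\<psi> 1} t \<partial>lborel)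
      = (\<integral>\<^sup>+t. k (\<psi> t) * ennreal (deriv \<psi> t) * indicator {0..1} t \<partial>lborel)"
    by (rule nn_integral_substitution_aux)
       (auto simp: assms has_derivative continuous_deriv deriv_nonneg)
  also have "\<dots> = (\<integral>\<^sup>+t. k (\<psi> t) * ennreal (deriv \<psi> t) \<partial>lborel)"
    by (intro nn_integral_cong) (auto simp: indicator_def deriv_outside)
  finally show ?thesis by (simp add: eq_0 eq_1)
qed

lemma det_jacobian_Psi: "det (jacobian (Psi \<psi>) (at x)) = (\<Prod>i\<in>UNIV. deriv \<psi> (x $ i))"
  for x :: "real ^ 'n"
proof -
  let ?D = "\<lambda>h :: real ^ 'n. \<chi> i. deriv \<psi> (x $ i) * h $ i"
  have "(Psi \<psi> has_derivative ?D) (at x)"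
  proof (subst has_derivative_componentwise_within, intro ballI)
    fix b :: "real ^ 'n" assume "b \<in> Basis"
    then obtain i where b: "b = axis i 1" by (auto simp: Basis_vec_def)
    have "((\<lambda>y :: real ^ 'n. y $ i) has_derivative (\<lambda>h. h $ i)) (at x)"
      by (intro bounded_linear_imp_has_derivative bounded_linear_vec_nth)
    moreover have "(\<psi> has_derivative (*) (deriv \<psi> (x $ i))) (at (x $ i))"
      using has_derivative[of "x $ i"] by (simp add: has_field_derivative_def)
    ultimately have "(\<psi> \<circ> (\<lambda>y :: real ^ 'n. y $ i) has_derivative (*) (deriv \<psi> (x $ i)) \<circ> (\<lambda>h. h $ i)) (at x)"
      by (rule diff_chain_at)
    then show "((\<lambda>y. Psi \<psi> y \<bullet> b) has_derivative (\<lambda>h. ?D h \<bullet> b)) (at x)"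
      by (simp add: b inner_axis Psi_def comp_def)
  qed
  then have "jacobian (Psi \<psi>) (at x) = matrix ?D"
    by (simp add: jacobian_def frechet_derivative_at[symmetric])
  also have "\<dots> = (\<chi> i j. if i = j then deriv \<psi> (x $ i) else 0)"
    by (auto simp: matrix_def axis_def vec_eq_iff)
  finally show ?thesis
    by (simp add: det_diagonal)
qed

lemma nn_integral_Psi:
  fixes h :: "real ^ 'n \<Rightarrow> ennreal"
  assumes "h \<in> borel_measurable borel"
  shows "(\<integral>\<^sup>+x. h (Psi \<psi> x) * ennreal (\<Prod>i\<in>UNIV. deriv \<psi> (x $ i)) \<partial>lborel)
    = (\<integral>\<^sup>+x. h x * indicator unit_cube x \<partial>lborel)"
proof (rule nn_integral_Psi_transfer[where \<psi> = \<psi> and \<psi>' = "deriv \<psi>" and h = h])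
  fix k :: "real \<Rightarrow> ennreal"
  assume "k \<in> borel_measurable borel"
  then show "(\<integral>\<^sup>+t. k (\<psi> t) * ennreal (deriv \<psi> t) \<partial>lborel) = (\<integral>\<^sup>+t. k t * indicator {0..1} t \<partial>lborel)"
    by (rule nn_integral_substitution[of k])
qed (rule measurable deriv_nonneg assms)+

end

section \<open>Measurability, matrix inverses and countability of the lattice\<close>

lemma borel_measurable_vec_nth [measurable (raw)]:
  fixes f :: "'a \<Rightarrow> 'b::euclidean_space ^ 'n"
  assumes "f \<in> borel_measurable M"
  shows "(\<lambda>x. f x $ i) \<in> borel_measurable M"
  by (rule measurable_compose[OF assms]) (intro borel_measurable_continuous_onI continuous_intros)

lemma borel_measurable_matrix_vector_mult [measurable (raw)]:
  fixes A :: "'a \<Rightarrow> real ^ 'n ^ 'm" and f :: "'a \<Rightarrow> real ^ 'n"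
  assumes [measurable]: "A \<in> borel_measurable M" "f \<in> borel_measurable M"
  shows "(\<lambda>x. A x *v f x) \<in> borel_measurable M"
  by (subst borel_measurable_euclidean_space)
     (auto simp: Basis_vec_def inner_axis matrix_vector_mult_def)

lemma borel_measurable_det [measurable (raw)]:
  fixes A :: "'a \<Rightarrow> real ^ 'n ^ 'n"
  assumes [measurable]: "A \<in> borel_measurable M"
  shows "(\<lambda>x. det (A x)) \<in> borel_measurable M"
  unfolding det_def by measurable

lemma matrix_inv_eqI:
  fixes A B :: "real ^ 'n ^ 'n"
  assumes "A ** B = mat 1"
  shows "matrix_inv A = B"
proof -
  have "B ** A = mat 1"
    using assms by (simp add: matrix_left_right_inverse)
  then have "A ** matrix_inv A = mat 1 \<and> matrix_inv A ** A = mat 1"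
    unfolding matrix_inv_def using assms by (intro someI_ex[of "\<lambda>C. A ** C = mat 1 \<and> C ** A = mat 1"]) blast
  then have "B ** (A ** matrix_inv A) = B"
    by simp
  then show ?thesis
    using \<open>B ** A = mat 1\<close> by (simp add: matrix_mul_assoc)
qed

lemma countable_int_lattice: "countable (int_lattice :: (real ^ 'n) set)"
proof -
  have "int_lattice \<subseteq> vec_lambda ` (PiE UNIV (\<lambda>_ :: 'n. \<int> :: real set))"
  proof
    fix m :: "real ^ 'n" assume "m \<in> int_lattice"
    then have "vec_nth m \<in> PiE UNIV (\<lambda>_. \<int>)"
      by (auto simp: int_lattice_def)
    then show "m \<in> vec_lambda ` (PiE UNIV (\<lambda>_ :: 'n. \<int> :: real set))"
      by (metis imageI vec_nth_inverse)
  qed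
  moreover have "countable (PiE UNIV (\<lambda>_ :: 'n. \<int> :: real set))"
    by (intro countable_PiE) (auto simp: countable_int)
  ultimately show ?thesis
    by (meson countable_image countable_subset)
qed

text \<open>Supplies joint measurability of weights and nodes in the sample point and the lattice
  point: with countably many slices, each slice can be treated separately.\<close>

lemma measurable_pair_measure_countable2:
  assumes "countable A" and "\<And>a. a \<in> A \<Longrightarrow> (\<lambda>x. f (x, a)) \<in> measurable M N"
  shows "f \<in> measurable (M \<Otimes>\<^sub>M count_space A) N"
  using measurable_compose_countable'[where f = "\<lambda>a p. f (fst p, a)" and g = snd and I = A
      and M = "M \<Otimes>\<^sub>M count_space A" and N = N] assms
  by (simp add: measurable_compose[OF measurable_fst])

section \<open>Tiling of space by lattice translates of the unit cube\<close>

lemma sets_unit_cube [measurable]: "unit_cube \<in> sets borel"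
  by (simp add: unit_cube_def)

lemma emeasure_unit_cube: "emeasure lborel (unit_cube :: (real ^ 'n) set) = 1"
proof -
  have "emeasure lborel (unit_cube :: (real ^ 'n) set)
      = (\<Prod>b\<in>Basis. ((\<chi> i. 1) - 0) \<bullet> (b :: real ^ 'n))"
    unfolding unit_cube_def by (rule emeasure_lborel_cbox) (auto simp: Basis_vec_def inner_axis)
  then show ?thesis by (simp add: prod_Basis_cart inner_axis)
qed

text \<open>Fubini for the counting measure and \<open>lborel\<close> turns the average into a sum
  of integrals over translated cubes. The translates of the half-open \<open>?H\<close> cover every
  point exactly once.\<close>

lemma nn_integral_lattice_tiling:
  fixes g :: "real ^ 'n \<Rightarrow> ennreal"
  assumes [measurable]: "g \<in> borel_measurable borel"
  shows "(\<integral>\<^sup>+v. (\<integral>\<^sup>+m. g (m + v) \<partial>count_space int_lattice) * indicator unit_cube v \<partial>lborel)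
    = (\<integral>\<^sup>+x. g x \<partial>lborel)"
proof -
  let ?L = "int_lattice :: (real ^ 'n) set"
  let ?H = "{x :: real ^ 'n. \<forall>i. 0 \<le> x $ i \<and> x $ i < 1}"
  interpret C: sigma_finite_measure "count_space ?L"
    by (rule sigma_finite_measure_count_space_countable) (rule countable_int_lattice)
  interpret pair_sigma_finite "count_space ?L" "lborel :: (real ^ 'n) measure" ..
  have [measurable]: "?H \<in> sets borel"
    by measurable
  define fl :: "real ^ 'n \<Rightarrow> real ^ 'n" where "fl x = (\<chi> i. of_int \<lfloor>x $ i\<rfloor>)" for x
  have fl: "fl x \<in> ?L" for x
    by (simp add: fl_def int_lattice_def)
  \<comment> \<open>The tile of \<open>fl x\<close> is the only one containing \<open>x\<close>: in
    each coordinate the two inequalities characterize the floor.\<close>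
  have in_H: "x - m \<in> ?H \<longleftrightarrow> m = fl x" if "m \<in> ?L" for x m
  proof -
    have "0 \<le> x $ i - m $ i \<and> x $ i - m $ i < 1 \<longleftrightarrow> m $ i = of_int \<lfloor>x $ i\<rfloor>" for i
    proof -
      have "m $ i \<in> \<int>"
        using that by (simp add: int_lattice_def)
      then obtain z where z: "m $ i = of_int z"
        by (rule Ints_cases)
      have "0 \<le> x $ i - of_int z \<and> x $ i - of_int z < 1 \<longleftrightarrow> z = \<lfloor>x $ i\<rfloor>"
        by linarith
      then show ?thesis
        by (simp add: z)
    qed
    then show ?thesis by (simp add: vec_eq_iff fl_def)
  qed
  have one_tile: "(\<integral>\<^sup>+m. g x * indicator ?H (x - m) \<partial>count_space ?L) = g x" for x
  proof -
    have "(\<integral>\<^sup>+m. g x * indicator ?H (x - m) \<partial>count_space ?L)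
        = (\<integral>\<^sup>+m. g x * indicator {fl x} m \<partial>count_space ?L)"
      by (intro nn_integral_cong) (simp add: indicator_def in_H[simplified])
    also have "\<dots> = g x"
      using fl[of x] by (subst nn_integral_cmult_indicator) auto
    finally show ?thesis .
  qed
  \<comment> \<open>The statement has the closed cube, the tiling the half-open one, which lies
    between the open and the closed cube. These two have equal volume, so the exchange costs a null
    set only.\<close>
  let ?O = "box 0 (\<chi> i. 1) :: (real ^ 'n) set"
  have "unit_cube - ?O \<in> null_sets lborel"
  proof -
    have "emeasure lborel (unit_cube - ?O) = emeasure lborel (unit_cube :: (real ^ 'n) set) - emeasure lborel ?O"
      using emeasure_lborel_box_finite[of 0 "\<chi> i. 1 :: real ^ 'n"]
      by (intro emeasure_Diff) (auto simp: unit_cube_def intro: subsetD[OF box_subset_cbox])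
    also have "\<dots> = 0"
      by (simp add: unit_cube_def emeasure_lborel_box_eq emeasure_lborel_cbox_eq)
    finally show ?thesis
      by (auto simp: null_sets_def)
  qed
  then have "AE v :: real ^ 'n in lborel. v \<notin> unit_cube - ?O"
    by (rule AE_not_in)
  then have cube_H: "AE v :: real ^ 'n in lborel. indicator unit_cube v = (indicator ?H v :: ennreal)"
    by eventually_elim (auto simp: indicator_def unit_cube_def mem_box_cart less_imp_le)
  have meas: "(\<lambda>(m, v). f m v) \<in> borel_measurable (count_space ?L \<Otimes>\<^sub>M lborel)"
    if "\<And>m. m \<in> ?L \<Longrightarrow> f m \<in> borel_measurable lborel" for f :: "real ^ 'n \<Rightarrow> real ^ 'n \<Rightarrow> ennreal"
    using that by (intro measurable_pair_measure_countable1[OF countable_int_lattice]) simp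
  have "(\<integral>\<^sup>+v. (\<integral>\<^sup>+m. g (m + v) \<partial>count_space ?L) * indicator unit_cube v \<partial>lborel)
      = (\<integral>\<^sup>+v. (\<integral>\<^sup>+m. g (m + v) * indicator ?H v \<partial>count_space ?L) \<partial>lborel)"
    by (rule nn_integral_cong_AE) (use cube_H in eventually_elim, simp add: nn_integral_multc)
  also have "\<dots> = (\<integral>\<^sup>+m. (\<integral>\<^sup>+v. g (m + v) * indicator ?H v \<partial>lborel) \<partial>count_space ?L)"
    by (rule Fubini') (rule meas, measurable)
  also have "\<dots> = (\<integral>\<^sup>+m. (\<integral>\<^sup>+x. g x * indicator ?H (x - m) \<partial>lborel) \<partial>count_space ?L)"
  proof (rule nn_integral_cong)
    fix m :: "real ^ 'n"
    have "(\<integral>\<^sup>+x. g x * indicator ?H (x - m) \<partial>distr lborel borel ((+) m))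
        = (\<integral>\<^sup>+v. g (m + v) * indicator ?H (m + v - m) \<partial>lborel)"
      by (rule nn_integral_distr) measurable
    then show "(\<integral>\<^sup>+v. g (m + v) * indicator ?H v \<partial>lborel) = (\<integral>\<^sup>+x. g x * indicator ?H (x - m) \<partial>lborel)"
      by (simp add: lborel_distr_plus)
  qed
  also have "\<dots> = (\<integral>\<^sup>+x. (\<integral>\<^sup>+m. g x * indicator ?H (x - m) \<partial>count_space ?L) \<partial>lborel)"
    by (rule Fubini'[symmetric]) (rule meas, measurable)
  finally show ?thesis by (simp add: one_tile)
qed

section \<open>The shifted quadrature for a fixed matrix\<close>

text \<open>With \<open>A\<close> the inverse transpose of \<open>S\<close>, the first factor is 1 /
  |det S| and the second the Jacobian determinant of \<open>Psi\<close>, so the quadrature becomes a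
  plain weighted sum. The last argument is the shifted lattice point before \<open>A\<close> is
  applied.\<close>

definition node_weight :: "(real \<Rightarrow> real) \<Rightarrow> real ^ 'n ^ 'n \<Rightarrow> real ^ 'n \<Rightarrow> real" where
  "node_weight \<psi> A x = \<bar>det A\<bar> * (\<Prod>i\<in>UNIV. deriv \<psi> ((A *v x) $ i))"

context unit_interval_transformation
begin

lemma measurable_Psi [measurable]: "Psi \<psi> \<in> borel_measurable borel"
  by (subst borel_measurable_euclidean_space) (auto simp: Psi_def Basis_vec_def inner_axis)

lemma node_weight_nonneg: "0 \<le> node_weight \<psi> A x"
  by (simp add: node_weight_def deriv_nonneg prod_nonneg)

lemma measurable_node_weight [measurable (raw)]:
  assumes [measurable]: "A \<in> borel_measurable M" "X \<in> borel_measurable M"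
  shows "(\<lambda>\<omega>. node_weight \<psi> (A \<omega>) (X \<omega>)) \<in> borel_measurable M"
  unfolding node_weight_def by measurable

text \<open>Tiling, linear substitution and \<open>nn_integral_Psi\<close> are applied in turn. With
  \<open>h\<close> nonnegative no question of convergence arises; later \<open>h\<close> is the
  indicator of a Borel set.\<close>

lemma nn_integral_shifted_quadrature:
  fixes h :: "real ^ 'n \<Rightarrow> ennreal"
  assumes A: "det A \<noteq> 0" and [measurable]: "h \<in> borel_measurable borel"
  shows "(\<integral>\<^sup>+v. (\<integral>\<^sup>+m. ennreal (node_weight \<psi> A (m + v)) * h (Psi \<psi> (A *v (m + v))) \<partial>count_space int_lattice)
      * indicator unit_cube v \<partial>lborel) = (\<integral>\<^sup>+x. h x * indicator unit_cube x \<partial>lborel)"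
proof -
  define k where "k x = h (Psi \<psi> x) * ennreal (\<Prod>i\<in>UNIV. deriv \<psi> (x $ i))" for x :: "real ^ 'n"
  have k[measurable]: "k \<in> borel_measurable borel"
    unfolding k_def by measurable
  have weight: "ennreal (node_weight \<psi> A x) * h (Psi \<psi> (A *v x)) = ennreal \<bar>det A\<bar> * k (A *v x)" for x
    by (simp add: node_weight_def k_def ennreal_mult' mult.commute mult.left_commute)
  have "(\<integral>\<^sup>+v. (\<integral>\<^sup>+m. ennreal (node_weight \<psi> A (m + v)) * h (Psi \<psi> (A *v (m + v))) \<partial>count_space int_lattice)
      * indicator unit_cube v \<partial>lborel) = (\<integral>\<^sup>+x. ennreal \<bar>det A\<bar> * k (A *v x) \<partial>lborel)"
    unfolding weight by (rule nn_integral_lattice_tiling) measurable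
  also have "\<dots> = ennreal \<bar>det A\<bar> * (\<integral>\<^sup>+x. k (A *v x) \<partial>lborel)"
    by (rule nn_integral_cmult) measurable
  also have "\<dots> = (\<integral>\<^sup>+x. k x \<partial>lborel)"
    using A k by (rule nn_integral_lborel_matrix)
  also have "\<dots> = (\<integral>\<^sup>+x. h x * indicator unit_cube x \<partial>lborel)"
    unfolding k_def by (rule nn_integral_Psi) measurable
  finally show ?thesis .
qed

end

section \<open>Almost sure modification and the inverse of the random matrix\<close>

text \<open>In a complete measure space all subsets of null sets are measurable, so a change on a
  null set keeps preimages measurable. This is how measurability reaches the quadrature of an
  arbitrary representative.\<close>

lemma measurable_completion_cong_AE:
  assumes f: "f \<in> measurable (completion M) N" and fg: "AE x in completion M. f x = g x"
    and g: "g \<in> space M \<rightarrow> space N"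
  shows "g \<in> measurable (completion M) N"
proof (rule measurableI)
  fix X assume X: "X \<in> sets N"
  from fg obtain Z where Z: "Z \<in> null_sets (completion M)"
    "{x \<in> space (completion M). f x \<noteq> g x} \<subseteq> Z"
    by (auto simp: eventually_ae_filter)
  have "g -` X \<inter> space (completion M) \<inter> Z \<in> sets (completion M)"
    using Z(1) by (intro completion.complete[of _ Z]) auto
  moreover have "f -` X \<inter> space (completion M) - Z \<in> sets (completion M)"
    using Z(1) measurable_sets[OF f X] by auto
  moreover have "g -` X \<inter> space (completion M)
      = (f -` X \<inter> space (completion M) - Z) \<union> (g -` X \<inter> space (completion M) \<inter> Z)"
    using Z(2) by auto
  ultimately show "g -` X \<inter> space (completion M) \<in> sets (completion M)"
    by (metis sets.Un)
qed (use g in auto)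

lemma abs_det_matrix_inv:
  fixes S :: "real ^ 'n ^ 'n"
  assumes "invertible S"
  shows "\<bar>det S\<bar> * \<bar>det (matrix_inv S)\<bar> = 1"
proof -
  obtain X where "S ** X = mat 1"
    using assms by (auto simp: invertible_right_inverse)
  then have "S ** matrix_inv S = mat 1"
    using matrix_inv_eqI by metis
  then have "det S * det (matrix_inv S) = 1"
    by (metis det_I det_mul)
  then show ?thesis by (simp flip: abs_mult)
qed

text \<open>The factors \<open>c * u $ i\<close> scale the rows of \<open>B\<close>, so their
  reciprocals scale the columns of the inverse. The explicit formula shows the inverse transpose as
  a measurable function of \<open>u\<close>.\<close>

lemma random_frolov_matrix_inv:
  fixes B :: "real ^ 'n ^ 'n"
  assumes B: "invertible B" and n: "n \<ge> 1" and u: "\<And>i. u $ i \<noteq> 0"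
  defines "c \<equiv> real n powr (1 / real CARD('n))"
  shows "invertible (random_frolov_matrix n B u)"
    and "transpose (matrix_inv (random_frolov_matrix n B u))
      = (\<chi> i j. matrix_inv B $ j $ i / (c * u $ i))"
proof -
  let ?S = "random_frolov_matrix n B u"
  let ?X = "\<chi> j i. matrix_inv B $ j $ i / (c * u $ i)"
  have c: "c \<noteq> 0"
    using n by (simp add: c_def)
  have S: "?S $ i $ j = c * u $ i * B $ i $ j" for i j
  proof -
    have "(diag_matrix u ** B) $ i $ j = (\<Sum>k\<in>UNIV. if k = i then u $ i * B $ i $ j else 0)"
      unfolding matrix_matrix_mult_def diag_matrix_def vec_lambda_beta by (rule sum.cong) auto
    then show ?thesis by (simp add: random_frolov_matrix_def c_def)
  qed
  obtain Y where "B ** Y = mat 1"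
    using B by (auto simp: invertible_right_inverse)
  then have B_inv: "B ** matrix_inv B = mat 1"
    using matrix_inv_eqI by metis
  have "(?S ** ?X) $ i $ j = mat 1 $ i $ j" for i j
  proof -
    have "(?S ** ?X) $ i $ j = (\<Sum>k\<in>UNIV. (c * u $ i) / (c * u $ j) * (B $ i $ k * matrix_inv B $ k $ j))"
      unfolding matrix_matrix_mult_def vec_lambda_beta by (rule sum.cong) (auto simp: S)
    also have "\<dots> = (c * u $ i) / (c * u $ j) * (B ** matrix_inv B) $ i $ j"
      by (simp add: matrix_matrix_mult_def sum_distrib_left)
    also have "\<dots> = mat 1 $ i $ j"
      using c u by (simp add: B_inv mat_def)
    finally show ?thesis .
  qed
  then have SX: "?S ** ?X = mat 1"
    by (simp add: vec_eq_iff)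
  then show "invertible ?S"
    by (auto simp: invertible_right_inverse)
  show "transpose (matrix_inv ?S) = (\<chi> i j. matrix_inv B $ j $ i / (c * u $ i))"
    by (simp add: matrix_inv_eqI[OF SX] transpose_def)
qed

section \<open>The law of the random nodes and unbiasedness\<close>

context unit_interval_transformation
begin

text \<open>\<open>quad_summand\<close> lacks the prefactor of the quadrature while
  \<open>node_weight\<close> includes it; hence the factor |det S|, which cancels in
  \<open>transformed_quadrature_eq\<close>.\<close>

lemma quad_summand_eq:
  fixes S :: "real ^ 'n ^ 'n"
  assumes "invertible S" and A: "transpose (matrix_inv S) = A"
  shows "quad_summand \<psi> S v g m = \<bar>det S\<bar> * (node_weight \<psi> A (m + v) * g (Psi \<psi> (A *v (m + v))))"
proof -
  have "\<bar>det S\<bar> * \<bar>det A\<bar> = 1"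
    using abs_det_matrix_inv[OF assms(1)] by (simp add: det_transpose flip: A)
  then have "\<bar>det S\<bar> * node_weight \<psi> A (m + v) = (\<Prod>i\<in>UNIV. deriv \<psi> ((A *v (m + v)) $ i))"
    by (simp add: node_weight_def flip: mult.assoc)
  then show ?thesis
    by (simp add: quad_summand_def A det_jacobian_Psi Let_def mult.commute flip: mult.assoc)
qed

lemma transformed_quadrature_eq:
  fixes S :: "real ^ 'n ^ 'n"
  assumes "invertible S" and "transpose (matrix_inv S) = A"
  shows "transformed_quadrature \<psi> S v g
    = (\<Sum>\<^sub>\<infinity>m\<in>int_lattice. node_weight \<psi> A (m + v) * g (Psi \<psi> (A *v (m + v))))"
proof -
  have "det S \<noteq> 0"
    using assms(1) by (simp add: invertible_det_nz)
  then show ?thesis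
    by (simp add: transformed_quadrature_def quad_summand_eq[OF assms] infsum_cmult_right')
qed

text \<open>By independence the joint law of \<open>U\<close> and \<open>V\<close> is a product, so
  \<open>V\<close> can be integrated out first with the matrix fixed. The result is the same for
  almost every \<open>u\<close>, and averaging over \<open>U\<close> returns it.\<close>

lemma distr_random_nodes:
  fixes A :: "real ^ 'n \<Rightarrow> real ^ 'n ^ 'n" and U V :: "'w \<Rightarrow> real ^ 'n"
  assumes M: "prob_space M" and A[measurable]: "A \<in> borel_measurable borel"
    and indep: "prob_space.indep_var M borel U borel V"
    and V: "uniformly_distributed M V unit_cube" and det: "AE \<omega> in M. det (A (U \<omega>)) \<noteq> 0"
  shows "distr (density (M \<Otimes>\<^sub>M count_space int_lattice) (\<lambda>(\<omega>, m). ennreal (node_weight \<psi> (A (U \<omega>)) (m + V \<omega>))))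
      borel (\<lambda>(\<omega>, m). Psi \<psi> (A (U \<omega>) *v (m + V \<omega>))) = density lborel (indicator unit_cube)"
proof -
  interpret prob_space M by fact
  let ?C = "count_space (int_lattice :: (real ^ 'n) set)"
  interpret C: sigma_finite_measure ?C
    by (rule sigma_finite_measure_count_space_countable) (rule countable_int_lattice)
  let ?w = "\<lambda>(\<omega>, m). ennreal (node_weight \<psi> (A (U \<omega>)) (m + V \<omega>))"
  let ?node = "\<lambda>(\<omega>, m). Psi \<psi> (A (U \<omega>) *v (m + V \<omega>))"
  have U_meas[measurable]: "U \<in> borel_measurable M" and V_meas[measurable]: "V \<in> borel_measurable M"
    and joint: "distr M borel U \<Otimes>\<^sub>M distr M borel V = distr M (borel \<Otimes>\<^sub>M borel) (\<lambda>\<omega>. (U \<omega>, V \<omega>))"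
    using indep unfolding indep_var_distribution_eq by auto
  interpret U: prob_space "distr M borel U" by (rule prob_space_distr) (rule U_meas)
  interpret V: prob_space "distr M borel V" by (rule prob_space_distr) (rule V_meas)
  have distr_V: "distr M borel V = uniform_measure lborel unit_cube"
    using V by (simp add: uniformly_distributed_def)
  have w[measurable]: "?w \<in> borel_measurable (M \<Otimes>\<^sub>M ?C)"
    by (rule measurable_pair_measure_countable2[OF countable_int_lattice]) simp
  have node[measurable]: "?node \<in> borel_measurable (M \<Otimes>\<^sub>M ?C)"
    by (rule measurable_pair_measure_countable2[OF countable_int_lattice]) simp
  show ?thesis
  proof (rule measure_eqI)
    fix X assume "X \<in> sets (distr (density (M \<Otimes>\<^sub>M ?C) ?w) borel ?node)"
    then have X[measurable]: "X \<in> sets borel" by simp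
    \<comment> \<open>Summing the weighted indicator of \<open>X\<close> over the lattice leaves a
      function of \<open>U\<close> and \<open>V\<close>, whose expectation is determined by their
      joint law.\<close>
    define F where "F p = (\<integral>\<^sup>+m. ennreal (node_weight \<psi> (A (fst p)) (m + snd p))
      * indicator X (Psi \<psi> (A (fst p) *v (m + snd p))) \<partial>?C)" for p :: "(real ^ 'n) \<times> (real ^ 'n)"
    have F[measurable]: "F \<in> borel_measurable (borel \<Otimes>\<^sub>M borel)"
      unfolding F_def
      by (rule C.borel_measurable_nn_integral)
         (rule measurable_pair_measure_countable2[OF countable_int_lattice], simp)
    let ?I = "\<integral>\<^sup>+x. indicator X x * indicator unit_cube x \<partial>lborel"
    have inner: "(\<integral>\<^sup>+v. F (u, v) \<partial>distr M borel V) = ?I" if "det (A u) \<noteq> 0" for u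
    proof -
      have [measurable]: "(\<lambda>v. F (u, v)) \<in> borel_measurable borel"
        by measurable
      have "(\<integral>\<^sup>+v. F (u, v) \<partial>distr M borel V) = (\<integral>\<^sup>+v. F (u, v) * indicator unit_cube v \<partial>lborel)"
        unfolding distr_V
        by (subst nn_integral_uniform_measure) (simp_all add: emeasure_unit_cube divide_ennreal_def)
      also have "\<dots> = ?I"
        unfolding F_def fst_conv snd_conv using that by (rule nn_integral_shifted_quadrature) measurable
      finally show ?thesis .
    qed
    have "emeasure (distr (density (M \<Otimes>\<^sub>M ?C) ?w) borel ?node) X
        = (\<integral>\<^sup>+x. indicator X x \<partial>distr (density (M \<Otimes>\<^sub>M ?C) ?w) borel ?node)"
      by simp
    also have "\<dots> = (\<integral>\<^sup>+p. ?w p * indicator X (?node p) \<partial>(M \<Otimes>\<^sub>M ?C))"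
      by (subst nn_integral_distr) (simp_all add: nn_integral_density)
    also have "\<dots> = (\<integral>\<^sup>+\<omega>. (\<integral>\<^sup>+m. ?w (\<omega>, m) * indicator X (?node (\<omega>, m)) \<partial>?C) \<partial>M)"
      by (rule C.nn_integral_fst[symmetric]) measurable
    also have "\<dots> = (\<integral>\<^sup>+\<omega>. F (U \<omega>, V \<omega>) \<partial>M)"
      by (simp add: F_def)
    also have "\<dots> = (\<integral>\<^sup>+p. F p \<partial>distr M (borel \<Otimes>\<^sub>M borel) (\<lambda>\<omega>. (U \<omega>, V \<omega>)))"
      by (rule nn_integral_distr[symmetric]) measurable
    also have "\<dots> = (\<integral>\<^sup>+p. F p \<partial>(distr M borel U \<Otimes>\<^sub>M distr M borel V))"
      by (simp add: joint)
    also have "\<dots> = (\<integral>\<^sup>+u. (\<integral>\<^sup>+v. F (u, v) \<partial>distr M borel V) \<partial>distr M borel U)"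
      by (rule V.nn_integral_fst[symmetric]) measurable
    also have "\<dots> = (\<integral>\<^sup>+u. ?I \<partial>distr M borel U)"
    proof (rule nn_integral_cong_AE)
      \<comment> \<open>The fixed matrix case applies where the determinant is nonzero; that this
        holds almost surely is carried over to the law of \<open>U\<close>.\<close>
      have "AE u in distr M borel U. det (A u) \<noteq> 0"
        using det by (subst AE_distr_iff) auto
      then show "AE u in distr M borel U. (\<integral>\<^sup>+v. F (u, v) \<partial>distr M borel V) = ?I"
        by eventually_elim (rule inner)
    qed
    also have "\<dots> = ?I"
      using U.emeasure_space_1 by simp
    also have "\<dots> = emeasure (density lborel (indicator unit_cube)) X"
      by (simp add: emeasure_density mult.commute)
    finally show "emeasure (distr (density (M \<Otimes>\<^sub>M ?C) ?w) borel ?node) X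
      = emeasure (density lborel (indicator unit_cube)) X" .
  qed simp
qed

text \<open>All three claims come from the law of the nodes: null sets of the cube pull back to null
  sets of the weighted product, and integrability of \<open>f\<close> becomes integrability over the
  product space, where Fubini applies.\<close>

lemma random_quadrature_unbiased:
  fixes S :: "'w \<Rightarrow> real ^ 'n ^ 'n" and A :: "real ^ 'n \<Rightarrow> real ^ 'n ^ 'n" and U V :: "'w \<Rightarrow> real ^ 'n"
  assumes M: "prob_space M" and A[measurable]: "A \<in> borel_measurable borel"
    and indep: "prob_space.indep_var M borel U borel V"
    and V: "uniformly_distributed M V unit_cube"
    and S: "AE \<omega> in M. invertible (S \<omega>) \<and> transpose (matrix_inv (S \<omega>)) = A (U \<omega>)"
    and f: "integrable (lebesgue_on unit_cube) f"
  shows "almost_surely_well_defined M \<psi> S V f"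
    and "integrable (completion M) (\<lambda>\<omega>. transformed_quadrature \<psi> (S \<omega>) (V \<omega>) f)"
    and "(\<integral>\<omega>. transformed_quadrature \<psi> (S \<omega>) (V \<omega>) f \<partial>completion M) = (\<integral>x. f x \<partial>lebesgue_on unit_cube)"
proof -
  interpret prob_space M by fact
  let ?L = "int_lattice :: (real ^ 'n) set"
  let ?C = "count_space ?L"
  interpret C: sigma_finite_measure ?C
    by (rule sigma_finite_measure_count_space_countable) (rule countable_int_lattice)
  interpret MC: pair_sigma_finite M ?C ..
  let ?w = "\<lambda>(\<omega>, m). node_weight \<psi> (A (U \<omega>)) (m + V \<omega>)"
  let ?node = "\<lambda>(\<omega>, m). Psi \<psi> (A (U \<omega>) *v (m + V \<omega>))"
  have [measurable]: "U \<in> borel_measurable M" "V \<in> borel_measurable M"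
    using indep unfolding indep_var_distribution_eq by auto
  have w[measurable]: "?w \<in> borel_measurable (M \<Otimes>\<^sub>M ?C)"
    by (rule measurable_pair_measure_countable2[OF countable_int_lattice]) simp
  have node[measurable]: "?node \<in> borel_measurable (M \<Otimes>\<^sub>M ?C)"
    by (rule measurable_pair_measure_countable2[OF countable_int_lattice]) simp
  have "AE \<omega> in M. det (A (U \<omega>)) \<noteq> 0"
    using S
  proof eventually_elim
    case (elim \<omega>)
    then show ?case
      using abs_det_matrix_inv[of "S \<omega>"] det_transpose[of "matrix_inv (S \<omega>)"] by auto
  qed
  then have distr: "distr (density (M \<Otimes>\<^sub>M ?C) (\<lambda>p. ennreal (?w p))) borel ?node = density lborel (indicator unit_cube)"
    using distr_random_nodes[OF M A indep V] by (simp add: case_prod_unfold)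

  \<comment> \<open>\<open>f\<close> is extended by 0 and then replaced by a Borel function
    \<open>F'\<close>, since a merely Lebesgue measurable function composed with the nodes need not
    be measurable.\<close>
  define F where "F x = (if x \<in> unit_cube then f x else 0)" for x
  have "integrable lebesgue F"
    using f unfolding F_def by (subst Lebesgue_Measure.integrable_restrict_UNIV) auto
  then obtain F' where F'[measurable]: "F' \<in> borel_measurable lborel" and FF': "AE x in lborel. F x = F' x"
    using completion_ex_borel_measurable_real[of F lborel] by auto
  have FF'_lebesgue: "AE x in lebesgue. F x = F' x"
    using FF' by (rule AE_completion)
  have F'_lebesgue: "integrable lebesgue F'" "integral\<^sup>L lebesgue F' = integral\<^sup>L lebesgue F"
    using \<open>integrable lebesgue F\<close> FF'_lebesgue integrable_cong_AE[of F lebesgue F'] integral_cong_AE[of F lebesgue F']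
    by (auto simp: measurable_completion)
  have f_integral: "(\<integral>x. f x \<partial>lebesgue_on unit_cube) = integral\<^sup>L lborel F'"
    using F'_lebesgue(2) unfolding F_def by (subst (asm) Lebesgue_Measure.integral_restrict_UNIV) (auto simp: integral_completion)
  have F'_int: "integrable lborel F'"
    using F'_lebesgue(1) by (simp add: integrable_completion)

  \<comment> \<open>Products are compared rather than values: at nodes of weight 0 the functions may
    differ, but both products vanish. An arbitrary \<open>g\<close> covers \<open>f\<close> and
    every other representative at once.\<close>
  have agree: "AE \<omega> in M. \<forall>m\<in>?L. ?w (\<omega>, m) * g (?node (\<omega>, m)) = ?w (\<omega>, m) * F' (?node (\<omega>, m))"
    if "AE x in lebesgue_on unit_cube. g x = f x" for g
  proof -
    have "AE x in lebesgue. x \<in> unit_cube \<longrightarrow> g x = f x"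
      using that by (subst (asm) AE_restrict_space_iff) auto
    then have "AE x in lborel. x \<in> unit_cube \<longrightarrow> g x = f x"
      by (simp add: AE_completion_iff)
    with FF' have "AE x in lborel. x \<in> unit_cube \<longrightarrow> g x = F' x"
      by eventually_elim (auto simp: F_def)
    then have "AE x in density lborel (indicator unit_cube). g x = F' x"
      by (subst AE_density) (auto simp: indicator_def)
    then have "AE p in density (M \<Otimes>\<^sub>M ?C) (\<lambda>p. ennreal (?w p)). g (?node p) = F' (?node p)"
      unfolding distr[symmetric] by (rule AE_distrD[rotated]) simp
    then have "AE p in M \<Otimes>\<^sub>M ?C. 0 < ennreal (?w p) \<longrightarrow> g (?node p) = F' (?node p)"
      by (subst (asm) AE_density) auto
    \<comment> \<open>Fubini for null sets; almost everywhere for the counting measure means at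
      every lattice point.\<close>
    then have "AE \<omega> in M. AE m in ?C. 0 < ennreal (?w (\<omega>, m)) \<longrightarrow> g (?node (\<omega>, m)) = F' (?node (\<omega>, m))"
      by (rule MC.AE_pair)
    then show ?thesis
      by eventually_elim
         (auto simp: AE_count_space node_weight_nonneg order_less_le)
  qed
  have quad: "AE \<omega> in M. transformed_quadrature \<psi> (S \<omega>) (V \<omega>) g = (\<Sum>\<^sub>\<infinity>m\<in>?L. ?w (\<omega>, m) * F' (?node (\<omega>, m)))"
    if "AE x in lebesgue_on unit_cube. g x = f x" for g
    using S agree[OF that]
  proof eventually_elim
    case (elim \<omega>)
    then have "transformed_quadrature \<psi> (S \<omega>) (V \<omega>) g = (\<Sum>\<^sub>\<infinity>m\<in>?L. ?w (\<omega>, m) * g (?node (\<omega>, m)))"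
      by (simp add: transformed_quadrature_eq[of "S \<omega>" "A (U \<omega>)"])
    also have "\<dots> = (\<Sum>\<^sub>\<infinity>m\<in>?L. ?w (\<omega>, m) * F' (?node (\<omega>, m)))"
      using elim(2) by (intro infsum_cong) blast
    finally show ?case .
  qed

  let ?G = "\<lambda>p. ?w p * F' (?node p)"
  \<comment> \<open>\<open>F'\<close> vanishes almost everywhere off the cube, so its integral over
    the cube is the one over the whole space.\<close>
  have F'_cube: "AE x in lborel. indicator unit_cube x * F' x = F' x"
    using FF' by eventually_elim (auto simp: F_def indicator_def split: if_splits)
  have dens: "density lborel (indicator unit_cube) = density lborel (\<lambda>x. ennreal (indicator unit_cube x))"
    by (simp add: ennreal_indicator)
  have F'_distr: "integrable (density lborel (indicator unit_cube)) F'"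
    "integral\<^sup>L (density lborel (indicator unit_cube)) F' = integral\<^sup>L lborel F'"
    unfolding dens using F'_int F'_cube
      integrable_cong_AE[of "\<lambda>x. indicator unit_cube x * F' x" lborel F']
      integral_cong_AE[of "\<lambda>x. indicator unit_cube x * F' x" lborel F']
    by (simp_all add: integrable_density integral_density)
  have w_nonneg: "AE p in M \<Otimes>\<^sub>M ?C. 0 \<le> ?w p"
    by (simp add: case_prod_unfold node_weight_nonneg)
  have F'_node: "(\<lambda>p. F' (?node p)) \<in> borel_measurable (M \<Otimes>\<^sub>M ?C)"
    by measurable
  \<comment> \<open>The law of the nodes carries integrability of \<open>F'\<close> to the weighted
    product space, which licenses Fubini for signed functions.\<close>
  have G_int: "integrable (M \<Otimes>\<^sub>M ?C) ?G"
    using F'_distr(1) w_nonneg F'_node unfolding distr[symmetric]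
    by (subst (asm) integrable_distr_eq) (auto simp: integrable_density)
  have "integral\<^sup>L (M \<Otimes>\<^sub>M ?C) ?G = integral\<^sup>L (density lborel (indicator unit_cube)) F'"
    using w_nonneg F'_node unfolding distr[symmetric]
    by (subst integral_distr) (auto simp: integral_density)
  with F'_distr(2) have G_integral: "integral\<^sup>L (M \<Otimes>\<^sub>M ?C) ?G = integral\<^sup>L lborel F'"
    by simp
  have G_AE: "AE \<omega> in M. integrable ?C (\<lambda>m. ?G (\<omega>, m))"
    using G_int by (rule MC.AE_integrable_fst')
  have summable: "(\<lambda>m. ?G (\<omega>, m)) summable_on ?L"
    and infsum: "(\<Sum>\<^sub>\<infinity>m\<in>?L. ?G (\<omega>, m)) = (\<integral>m. ?G (\<omega>, m) \<partial>?C)"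
    if "integrable ?C (\<lambda>m. ?G (\<omega>, m))" for \<omega>
  proof -
    \<comment> \<open>Integrability against the counting measure is absolute summability in the
      sense of \<open>infsetsum\<close>; the equivalences below pass to
      \<open>infsum\<close>.\<close>
    have abs: "Infinite_Set_Sum.abs_summable_on (\<lambda>m. ?G (\<omega>, m)) ?L"
      unfolding Infinite_Set_Sum.abs_summable_on_def by (rule that)
    then show "(\<lambda>m. ?G (\<omega>, m)) summable_on ?L"
      by (rule summable_on_iff_abs_summable_on_real[THEN iffD2, OF abs_summable_equivalent[THEN iffD2]])
    show "(\<Sum>\<^sub>\<infinity>m\<in>?L. ?G (\<omega>, m)) = (\<integral>m. ?G (\<omega>, m) \<partial>?C)"
      using infsetsum_infsum[OF abs] unfolding infsetsum_def by (rule sym)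
  qed

  show "almost_surely_well_defined M \<psi> S V f"
    unfolding almost_surely_well_defined_def
  proof (intro conjI allI impI)
    show "AE \<omega> in M. invertible (S \<omega>) \<and> quad_summand \<psi> (S \<omega>) (V \<omega>) f summable_on ?L"
      using S agree[of f, simplified] G_AE
    proof eventually_elim
      case (elim \<omega>)
      then have "(\<lambda>m. \<bar>det (S \<omega>)\<bar> * ?G (\<omega>, m)) summable_on ?L"
        by (intro summable_on_cmult_right summable)
      moreover have "quad_summand \<psi> (S \<omega>) (V \<omega>) f m = \<bar>det (S \<omega>)\<bar> * ?G (\<omega>, m)" if "m \<in> ?L" for m
        using elim that by (simp add: quad_summand_eq[of "S \<omega>" "A (U \<omega>)"])
      ultimately show ?case
        using elim(1) by (simp cong: summable_on_cong)
    qed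
    fix g assume "AE x in lebesgue_on unit_cube. g x = f x"
    from quad[OF this] quad[of f, simplified]
    show "AE \<omega> in M. transformed_quadrature \<psi> (S \<omega>) (V \<omega>) g = transformed_quadrature \<psi> (S \<omega>) (V \<omega>) f"
      by eventually_elim simp
  qed

  let ?Q = "\<lambda>\<omega>. transformed_quadrature \<psi> (S \<omega>) (V \<omega>) f"
  let ?E = "\<lambda>\<omega>. \<integral>m. ?G (\<omega>, m) \<partial>?C"
  \<comment> \<open>\<open>?E\<close> is measurable on \<open>M\<close> itself. The quadrature
    agrees with it almost surely and so inherits measurability on the completion.\<close>
  have E_meas: "?E \<in> borel_measurable M" and E_int: "integrable M ?E"
    using MC.integrable_fst'[OF G_int] by auto
  have "AE \<omega> in M. ?E \<omega> = ?Q \<omega>"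
    using quad[of f, simplified] G_AE
  proof eventually_elim
    case (elim \<omega>)
    then show ?case
      using infsum[of \<omega>] by simp
  qed
  then have QE: "AE \<omega> in completion M. ?E \<omega> = ?Q \<omega>"
    by (rule AE_completion)
  have E_meas': "?E \<in> borel_measurable (completion M)"
    using E_meas by (rule measurable_completion)
  have Q_meas: "?Q \<in> borel_measurable (completion M)"
    using E_meas' QE by (rule measurable_completion_cong_AE) simp
  show "integrable (completion M) ?Q"
    using integrable_cong_AE[OF E_meas' Q_meas QE] E_int E_meas by (simp add: integrable_completion)
  have "integral\<^sup>L (completion M) ?Q = integral\<^sup>L M ?E"
    using integral_cong_AE[OF E_meas' Q_meas QE] E_meas by (simp add: integral_completion)
  also have "\<dots> = integral\<^sup>L lborel F'"
    using MC.integral_fst'[OF G_int] G_integral by simp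
  finally show "integral\<^sup>L (completion M) ?Q = (\<integral>x. f x \<partial>lebesgue_on unit_cube)"
    by (simp add: f_integral)
qed

end

section \<open>Application to the randomly dilated Frolov matrix\<close>

theorem proposition2:
  fixes n :: nat
    and B :: "real ^ 'd ^ 'd"
    and \<psi> :: "real \<Rightarrow> real"
    and M :: "'w measure"
    and U V :: "'w \<Rightarrow> real ^ 'd"
  assumes "n \<ge> 1"
    and "frolov_matrix B"
    and "smooth_on \<psi> UNIV"
    and "\<And>t. t < 0 \<Longrightarrow> \<psi> t = 0"
    and "\<And>t. t > 1 \<Longrightarrow> \<psi> t = 1"
    and "diffeomorphism_between \<psi> {0<..<1} {0<..<1}"
    and "prob_space M"
    and "uniformly_distributed M U dilation_cube"
    and "uniformly_distributed M V unit_cube"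
    and "prob_space.indep_var M borel U borel V"
  shows "\<forall>f :: real ^ 'd \<Rightarrow> real. integrable (lebesgue_on unit_cube) f \<longrightarrow>
      almost_surely_well_defined M \<psi> (\<lambda>\<omega>. random_frolov_matrix n B (U \<omega>)) V f \<and>
      integrable (completion M)
        (\<lambda>\<omega>. transformed_quadrature \<psi> (random_frolov_matrix n B (U \<omega>)) (V \<omega>) f) \<and>
      (\<integral>\<omega>. transformed_quadrature \<psi> (random_frolov_matrix n B (U \<omega>)) (V \<omega>) f \<partial>completion M)
        = (\<integral>x. f x \<partial>lebesgue_on unit_cube)"
proof -
  interpret unit_interval_transformation \<psi>
    using assms(3-6) by unfold_locales
  interpret prob_space M by fact
  define c where "c = real n powr (1 / real CARD('d))"
  \<comment> \<open>Division by 0 yields 0, so \<open>A\<close> is Borel measurable on the whole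
    space, including points with a zero coordinate.\<close>
  define A :: "real ^ 'd \<Rightarrow> real ^ 'd ^ 'd" where "A u = (\<chi> i j. matrix_inv B $ j $ i / (c * u $ i))" for u
  have A: "A \<in> borel_measurable borel"
    by (subst borel_measurable_euclidean_space) (auto simp: A_def Basis_vec_def inner_axis)
  have U_meas: "U \<in> borel_measurable M" and distr_U: "distr M borel U = uniform_measure lborel dilation_cube"
    using assms(8) by (auto simp: uniformly_distributed_def)
  \<comment> \<open>Points of the dilation cube have coordinates at least 1, so the scaling of the
    rows of \<open>B\<close> is almost surely invertible.\<close>
  have "AE u in distr M borel U. u \<in> dilation_cube"
    unfolding distr_U by (rule AE_uniform_measureI) (auto simp: dilation_cube_def)
  then have "AE \<omega> in M. U \<omega> \<in> dilation_cube"
    using U_meas by (rule AE_distrD[rotated])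
  then have "AE \<omega> in M. invertible (random_frolov_matrix n B (U \<omega>))
      \<and> transpose (matrix_inv (random_frolov_matrix n B (U \<omega>))) = A (U \<omega>)"
  proof eventually_elim
    case (elim \<omega>)
    then have "U \<omega> $ i \<noteq> 0" for i
      by (auto simp: dilation_cube_def mem_box_cart) (metis not_one_le_zero)
    moreover have "invertible B"
      using assms(2) by (simp add: frolov_matrix_def)
    ultimately show ?case
      using random_frolov_matrix_inv[of B n "U \<omega>"] assms(1) by (simp add: A_def c_def)
  qed
  from random_quadrature_unbiased[OF assms(7) A assms(10,9) this]
  show ?thesis by simp
qed

end
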